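(* Let $\mathcal{X}$ be a finite non-empty set and let $\overline{T}\colon\mathbb{R}^{\mathcal{X}}\to\mathbb{R}^{\mathcal{X}}$ be an upper transition operator with maximal communication classes $\mathcal{X}_{\mathrm{m},1},\dots,\mathcal{X}_{\mathrm{m},M}$ such that $\mathcal{X}_{\mathrm{t}\triangledown}=\emptyset$, i.e. such that the union $\mathcal{X}_{\mathrm{m}}$ of the maximal communication classes is lower reachable from every state in $\mathcal{X}\setminus\mathcal{X}_{\mathrm{m}}$. Then $\overline{T}$ is convergent if and only if $\mathcal{X}_{\mathrm{m},1},\dots,\mathcal{X}_{\mathrm{m},M}$ are all regular.
   Context: $\mathbb{N}=\{1,2,\dots\}$; order on functions is pointwise; constants are identified with constant functions; $\mathbb{1}_A$ is the indicator of $A$ and $\mathbb{1}_y=\mathbb{1}_{\{y\}}$. Upper transition operator on $\mathcal{X}$: a map $\overline{T}\colon\mathbb{R}^{\mathcal{X}}\to\mathbb{R}^{\mathcal{X}}$ with $\overline{T}(f+g)\le\overline{T}f+\overline{T}g$, $\overline{T}(\lambda f)=\lambda\overline{T}f$ for real $\lambda\ge0$, and $\overline{T}f\le\max f$. Its conjugate lower transition operator is $\underline{T}f:=-\overline{T}(-f)$. $\overline{T}$ is convergent if $(\overline{T}^nf)_{n\in\mathbb{N}}$ converges for all $f\in\mathbb{R}^{\mathcal{X}}$. The upper accessibility graph of $\overline{T}$ has node set $\mathcal{X}$ and a directed edge from $x$ to $y$ iff $\overline{T}\mathbb{1}_y(x)>0$. $y$ is accessible from $x$ if $y=x$ or there is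 a directed path from $x$ to $y$. Two states communicate if each is accessible from the other; the equivalence classes are the communication classes. A communication class is maximal if no state outside it is accessible from a state in it. A maximal communication class $C$ is regular if the greatest common divisor of the lengths of the closed directed paths staying in $C$ is $1$; equivalently, if there is $N\in\mathbb{N}$ with $\overline{T}^n\mathbb{1}_y(x)>0$ for all $n\ge N$ and $x,y\in C$. A non-empty set $C\subseteq\mathcal{X}$ is lower reachable from $x$ if $\underline{T}^n\mathbb{1}_C(x)>0$ for some $n\in\mathbb{N}$. $\mathcal{X}_{\mathrm{m}}$ is the union of the maximal communication classes and $\mathcal{X}_{\mathrm{t}\triangledown}$ is the set of states in $\mathcal{X}\setminus\mathcal{X}_{\mathrm{m}}$ from which $\mathcal{X}_{\mathrm{m}}$ is not lower reachable. *)

theory Defs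
  imports "HOL-Analysis.Analysis"
begin

text \<open>The finite non-empty state space is the universe of a type \<open>'x :: finite\<close>.\<close>

definition upper_transition_operator :: "(('x::finite \<Rightarrow> real) \<Rightarrow> ('x \<Rightarrow> real)) \<Rightarrow> bool" where
  "upper_transition_operator T \<longleftrightarrow>
     (\<forall>f g. T (\<lambda>x. f x + g x) \<le> (\<lambda>x. T f x + T g x)) \<and>
     (\<forall>c f. c \<ge> 0 \<longrightarrow> T (\<lambda>x. c * f x) = (\<lambda>x. c * T f x)) \<and>
     (\<forall>f. T f \<le> (\<lambda>x. Max (range f)))"

definition conj_lower :: "(('x \<Rightarrow> real) \<Rightarrow> ('x \<Rightarrow> real)) \<Rightarrow> ('x \<Rightarrow> real) \<Rightarrow> ('x \<Rightarrow> real)" where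
  "conj_lower T f = (\<lambda>x. - T (\<lambda>y. - f y) x)"

text \<open>Convergence is in the product topology on \<open>'x \<Rightarrow> real\<close>, that is, pointwise.\<close>

definition convergent_operator :: "(('x::finite \<Rightarrow> real) \<Rightarrow> ('x \<Rightarrow> real)) \<Rightarrow> bool" where
  "convergent_operator T \<longleftrightarrow> (\<forall>f. convergent (\<lambda>n. (T ^^ n) f))"

definition upper_access_graph :: "(('x \<Rightarrow> real) \<Rightarrow> ('x \<Rightarrow> real)) \<Rightarrow> 'x rel" where
  "upper_access_graph T = {(x, y). T (indicat_real {y}) x > 0}"

definition accessible :: "(('x \<Rightarrow> real) \<Rightarrow> ('x \<Rightarrow> real)) \<Rightarrow> 'x rel" where
  "accessible T = (upper_access_graph T)\<^sup>*"

definition communicate :: "(('x \<Rightarrow> real) \<Rightarrow> ('x \<Rightarrow> real)) \<Rightarrow> 'x rel" where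
  "communicate T = {(x, y). (x, y) \<in> accessible T \<and> (y, x) \<in> accessible T}"

definition communication_classes :: "(('x \<Rightarrow> real) \<Rightarrow> ('x \<Rightarrow> real)) \<Rightarrow> 'x set set" where
  "communication_classes T = UNIV // communicate T"

definition maximal_classes :: "(('x \<Rightarrow> real) \<Rightarrow> ('x \<Rightarrow> real)) \<Rightarrow> 'x set set" where
  "maximal_classes T =
     {C \<in> communication_classes T. \<forall>x\<in>C. \<forall>y. y \<notin> C \<longrightarrow> (x, y) \<notin> accessible T}"

text \<open>
  A directed path of length \<open>n\<close> from \<open>x\<close> to \<open>y\<close> staying in \<open>C\<close> exists iff \<open>(x, y)\<close> lies in the
  \<open>n\<close>-th relational power of the edge relation restricted to \<open>C\<close>. Paths may revisit states.
\<close>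

definition closed_path_lengths :: "(('x \<Rightarrow> real) \<Rightarrow> ('x \<Rightarrow> real)) \<Rightarrow> 'x set \<Rightarrow> nat set" where
  "closed_path_lengths T C =
     {n. n \<ge> 1 \<and> (\<exists>x\<in>C. (x, x) \<in> (upper_access_graph T \<inter> C \<times> C) ^^ n)}"

definition regular_class :: "(('x \<Rightarrow> real) \<Rightarrow> ('x \<Rightarrow> real)) \<Rightarrow> 'x set \<Rightarrow> bool" where
  "regular_class T C \<longleftrightarrow> Gcd (closed_path_lengths T C) = 1"

definition lower_reachable :: "(('x \<Rightarrow> real) \<Rightarrow> ('x \<Rightarrow> real)) \<Rightarrow> 'x set \<Rightarrow> 'x \<Rightarrow> bool" where
  "lower_reachable T C x \<longleftrightarrow>
     C \<noteq> {} \<and> (\<exists>n\<ge>1. (conj_lower T ^^ n) (indicat_real C) x > 0)"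

definition maximal_states :: "(('x \<Rightarrow> real) \<Rightarrow> ('x \<Rightarrow> real)) \<Rightarrow> 'x set" where
  "maximal_states T = \<Union> (maximal_classes T)"

definition non_absorbed_states :: "(('x \<Rightarrow> real) \<Rightarrow> ('x \<Rightarrow> real)) \<Rightarrow> 'x set" where
  "non_absorbed_states T =
     {x. x \<notin> maximal_states T \<and> \<not> lower_reachable T (maximal_states T) x}"

end

theory Submission
  imports Defs
begin

text \<open>
  \<open>T f x\<close> depends only on the values of \<open>f\<close> at the successors of \<open>x\<close>, so maximal classes evolve
  autonomously. On a class of period \<open>d \<noteq> 1\<close>, the iterates of the indicator of a cyclic subclass
  rotate through the \<open>d\<close> cyclic subclasses and do not converge. On a regular class some power
  \<open>T\<^sup>N\<close> has all \<open>T\<^sup>N 1\<^sub>y(x)\<close> bounded below by \<open>e > 0\<close>, so it shrinks the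
  oscillation of \<open>f\<close> on the class by the factor \<open>1 - e\<close>. Outside the maximal classes, lower
  reachability says that \<open>u\<^sub>n = T\<^sup>n 1\<^sub>A\<close>, with \<open>A\<close> the set of states outside the maximal
  classes, tends to \<open>0\<close>. If \<open>T\<^sup>m f\<close> and \<open>T\<^sup>n f\<close> differ by at most \<open>r\<close> off \<open>A\<close> and are
  bounded by \<open>M\<close>, then \<open>T\<^sup>k\<close> of them differ by at most \<open>r + 2 M u\<^sub>k\<close>, so the iterates form a
  Cauchy sequence.
\<close>

section \<open>Additive semigroups of naturals and primitivity of graphs\<close>

lemma add_closed_contains_all_large:
  fixes S :: "nat set"
  assumes add: "\<And>a b. a \<in> S \<Longrightarrow> b \<in> S \<Longrightarrow> a + b \<in> S"
    and gcd: "Gcd S = 1"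
  shows "\<exists>N. \<forall>n\<ge>N. n \<in> S"
proof -
  have mult: "k * a + b \<in> S" if "a \<in> S" "b \<in> S" for k a b
    using that by (induction k) (auto simp: add.assoc intro: add)
  obtain s where s: "s \<in> S" "s > 0"
    using gcd by (metis Gcd_0_iff bot_nat_0.not_eq_extremum insertI1 subsetI zero_neq_one)
  \<comment> \<open>\<open>P\<close> collects the positive differences of elements of
    \<open>S\<close>. The least one divides every \<open>t\<close> in \<open>S\<close>, since
    otherwise \<open>t mod d\<close> would be a smaller difference; so it divides
    \<open>Gcd S\<close> and equals 1.\<close>
  define P where "P d \<longleftrightarrow> d > 0 \<and> (\<exists>a\<in>S. a + d \<in> S)" for d
  have "P s"
    using s add by (auto simp: P_def)
  define d where "d = (LEAST d. P d)"
  have "P d" and d_least: "\<And>e. P e \<Longrightarrow> d \<le> e"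
    using \<open>P s\<close> unfolding d_def by (auto intro: LeastI Least_le)
  then obtain a where a: "d > 0" "a \<in> S" "a + d \<in> S"
    by (auto simp: P_def)
  have "d dvd t" if t: "t \<in> S" for t
  proof (rule ccontr)
    assume "\<not> d dvd t"
    then have r: "t mod d > 0"
      by (simp add: dvd_eq_mod_eq_0)
    have "(t div d) * (a + d) + a \<in> S" "(t div d) * a + (t + a) \<in> S"
      using a t by (auto intro!: add mult)
    moreover have "(t div d) * a + (t + a) = ((t div d) * (a + d) + a) + t mod d"
      by (simp add: algebra_simps)
    ultimately have "P (t mod d)"
      using r unfolding P_def by metis
    then show False
      using d_least a(1) by (meson mod_less_divisor not_le)
  qed
  then have "d dvd Gcd S"
    by (auto intro: Gcd_greatest)
  then have d: "d = 1"
    using gcd by simp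
  \<comment> \<open>Now \<open>a\<close> and \<open>a + 1\<close> lie in \<open>S\<close>; adding
    \<open>s\<close> keeps them consecutive and makes the smaller one positive.\<close>
  define b where "b = a + s"
  have b: "b > 0" "b \<in> S" "Suc b \<in> S"
    using a s d add[of a s] add[of "a + d" s] by (auto simp: b_def)
  have "n \<in> S" if n: "n \<ge> b * b" for n
  proof -
    have "b \<le> n div b" "n mod b < b"
      using n b(1) by (auto simp: less_eq_div_iff_mult_less_eq)
    \<comment> \<open>Since \<open>n mod b < n div b\<close>, the number \<open>n\<close> splits
      into \<open>n mod b\<close> copies of \<open>b + 1\<close> and \<open>k + 1\<close> copies of
      \<open>b\<close>. The last copy of \<open>b\<close> is the summand that \<open>mult\<close>
      requires, as 0 may lie outside \<open>S\<close>.\<close>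
    then obtain k where k: "n div b = n mod b + Suc k"
      by (metis less_iff_Suc_add less_le_trans add_Suc_right)
    have "n = n div b * b + n mod b"
      by simp
    also have "\<dots> = n mod b * Suc b + (k * b + b)"
      unfolding k by (simp add: algebra_simps)
    also have "\<dots> \<in> S"
      using b by (intro mult)
    finally show ?thesis .
  qed
  then show ?thesis
    by blast
qed

lemma relpow_subset_mono:
  fixes R S :: "'a rel"
  shows "R \<subseteq> S \<Longrightarrow> R ^^ n \<subseteq> S ^^ n"
  by (induction n) (auto simp: relcomp_mono)

text \<open>The return times of one state \<open>x\<close> form an additive semigroup. Inserting a
  closed path at \<open>z\<close> into a loop through \<open>x\<close> and \<open>z\<close>
  lengthens the loop by that path, so the gcd of the return times divides all closed path lengths
  and is 1. Hence every large number is a return time; a path from \<open>x\<close> to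
  \<open>y\<close> is then appended.\<close>

lemma strongly_connected_aperiodic_imp_primitive:
  assumes fin: "finite C"
    and conn: "\<And>x y. x \<in> C \<Longrightarrow> y \<in> C \<Longrightarrow> (x, y) \<in> E\<^sup>*"
    and gcd: "Gcd {n. n \<ge> 1 \<and> (\<exists>x\<in>C. (x, x) \<in> E ^^ n)} = 1"
  shows "\<exists>N. \<forall>n\<ge>N. \<forall>x\<in>C. \<forall>y\<in>C. (x, y) \<in> E ^^ n"
proof -
  have closed: "\<exists>N. \<forall>n\<ge>N. (x, x) \<in> E ^^ n" if x: "x \<in> C" for x
  proof -
    define S where "S = {n. (x, x) \<in> E ^^ n}"
    have "Gcd S dvd n" if z: "z \<in> C" "(z, z) \<in> E ^^ n" for z n
    proof -
      obtain p q where p: "(x, z) \<in> E ^^ p" and q: "(z, x) \<in> E ^^ q"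
        using conn[OF x z(1)] conn[OF z(1) x] unfolding rtrancl_power by blast
      have "(x, x) \<in> E ^^ (p + q)" "(x, x) \<in> E ^^ (p + n + q)"
        using p q z(2) by (auto simp: relpow_add)
      then have "Gcd S dvd p + q" "Gcd S dvd (p + q) + n"
        by (auto simp: S_def ac_simps intro!: Gcd_dvd)
      then show ?thesis
        by (simp only: dvd_add_right_iff)
    qed
    then have "Gcd S dvd Gcd {n. n \<ge> 1 \<and> (\<exists>x\<in>C. (x, x) \<in> E ^^ n)}"
      by (auto intro: Gcd_greatest)
    then have "Gcd S = 1"
      using gcd by simp
    moreover have "a + b \<in> S" if "a \<in> S" "b \<in> S" for a b
      using that by (auto simp: S_def relpow_add)
    ultimately show ?thesis
      using add_closed_contains_all_large[of S] by (auto simp: S_def)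
  qed
  have "\<exists>N. \<forall>n\<ge>N. (x, y) \<in> E ^^ n" if xy: "x \<in> C" "y \<in> C" for x y
  proof -
    obtain N where N: "\<And>n. n \<ge> N \<Longrightarrow> (x, x) \<in> E ^^ n"
      using closed xy by blast
    obtain p where p: "(x, y) \<in> E ^^ p"
      using conn xy by (meson rtrancl_imp_relpow)
    have "(x, y) \<in> E ^^ n" if "n \<ge> N + p" for n
    proof -
      have "(x, y) \<in> E ^^ (n - p + p)"
        using N[of "n - p"] p that by (intro relpow_trans) auto
      then show ?thesis
        using that by simp
    qed
    then show ?thesis
      by blast
  qed
  then obtain N where N: "\<And>x y n. x \<in> C \<Longrightarrow> y \<in> C \<Longrightarrow> n \<ge> N x y \<Longrightarrow> (x, y) \<in> E ^^ n"
    by metis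
  define K where "K = Max ((\<lambda>(x, y). N x y) ` (C \<times> C))"
  have "N x y \<le> K" if "x \<in> C" "y \<in> C" for x y
    unfolding K_def using fin that by (intro Max_ge) auto
  then show ?thesis
    using N by (meson order_trans)
qed

lemma tendsto_fun_iff:
  fixes f :: "'a \<Rightarrow> 'b \<Rightarrow> 'c::topological_space"
  shows "(f \<longlongrightarrow> l) F \<longleftrightarrow> (\<forall>x. ((\<lambda>n. f n x) \<longlongrightarrow> l x) F)"
  using limitin_componentwise[of "\<lambda>_. euclidean" UNIV f l F]
  by (simp add: euclidean_product_topology)

section \<open>Order and algebra of upper transition operators\<close>

locale upper_transition =
  fixes T :: "('x::finite \<Rightarrow> real) \<Rightarrow> ('x \<Rightarrow> real)"
  assumes upper: "upper_transition_operator T"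
begin

lemma subadditive: "T (\<lambda>x. f x + g x) x \<le> T f x + T g x"
  using upper by (auto simp: upper_transition_operator_def le_fun_def)

lemma homogeneous: "c \<ge> 0 \<Longrightarrow> T (\<lambda>x. c * f x) x = c * T f x"
  using upper by (auto simp: upper_transition_operator_def)

lemma upper_bound:
  assumes "\<And>y. f y \<le> c"
  shows "T f x \<le> c"
proof -
  have "T f x \<le> Max (range f)"
    using upper by (auto simp: upper_transition_operator_def le_fun_def)
  also have "\<dots> \<le> c"
    using assms by auto
  finally show ?thesis .
qed

lemma const [simp]: "T (\<lambda>_. c) x = c"
proof -
  have "T (\<lambda>_. 0) x = 0"
    using homogeneous[of 0 "\<lambda>_. 0" x] by simp
  then have "0 \<le> T (\<lambda>_. c) x + T (\<lambda>_. - c) x"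
    using subadditive[of "\<lambda>_. c" "\<lambda>_. - c" x] by simp
  moreover have "T (\<lambda>_. c) x \<le> c" "T (\<lambda>_. - c) x \<le> - c"
    by (auto intro: upper_bound)
  ultimately show ?thesis
    by linarith
qed

lemma mono:
  assumes "\<And>y. f y \<le> g y"
  shows "T f x \<le> T g x"
proof -
  have "T f x \<le> T g x + T (\<lambda>y. f y - g y) x"
    using subadditive[of g "\<lambda>y. f y - g y" x] by simp
  moreover have "T (\<lambda>y. f y - g y) x \<le> 0"
    using assms by (intro upper_bound) simp
  ultimately show ?thesis
    by linarith
qed

lemma add_const: "T (\<lambda>y. f y + c) x = T f x + c"
  using subadditive[of f "\<lambda>_. c" x] subadditive[of "\<lambda>y. f y + c" "\<lambda>_. - c" x] by simp

lemma sum_indicator_le: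
  assumes "finite A" "\<And>y. c y \<ge> 0"
  shows "T (\<lambda>z. \<Sum>y\<in>A. c y * indicat_real {y} z) x \<le> (\<Sum>y\<in>A. c y * T (indicat_real {y}) x)"
  using assms(1)
proof induction
  case (insert a A)
  have "T (\<lambda>z. \<Sum>y\<in>insert a A. c y * indicat_real {y} z) x
      \<le> T (\<lambda>z. c a * indicat_real {a} z) x + T (\<lambda>z. \<Sum>y\<in>A. c y * indicat_real {y} z) x"
    unfolding sum.insert[OF insert.hyps] by (rule subadditive)
  also have "\<dots> \<le> (\<Sum>y\<in>insert a A. c y * T (indicat_real {y}) x)"
    using insert assms(2) by (simp add: homogeneous)
  finally show ?case .
qed simp

section \<open>Locality with respect to the access graph\<close>

abbreviation "G \<equiv> upper_access_graph T"

text \<open>The excess \<open>c\<close> of \<open>f\<close> over \<open>g\<close> is a nonnegative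
  combination of point indicators. At a successor its coefficient vanishes; elsewhere the indicator
  has upper value at most 0 at \<open>x\<close>. So subadditivity adds nothing.\<close>

lemma le_if_le_on_successors:
  assumes "\<And>y. (x, y) \<in> G \<Longrightarrow> f y \<le> g y"
  shows "T f x \<le> T g x"
proof -
  define c where "c y = max 0 (f y - g y)" for y
  have "(\<Sum>z\<in>UNIV. c z * indicat_real {z} y) = c y" for y
    by (simp add: indicator_def)
  then have "T f x \<le> T (\<lambda>y. g y + (\<Sum>z\<in>UNIV. c z * indicat_real {z} y)) x"
    by (intro mono) (auto simp: c_def)
  also have "\<dots> \<le> T g x + T (\<lambda>y. \<Sum>z\<in>UNIV. c z * indicat_real {z} y) x"
    by (rule subadditive)
  also have "T (\<lambda>y. \<Sum>z\<in>UNIV. c z * indicat_real {z} y) x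
      \<le> (\<Sum>z\<in>UNIV. c z * T (indicat_real {z}) x)"
    by (rule sum_indicator_le) (auto simp: c_def)
  also have "(\<Sum>z\<in>UNIV. c z * T (indicat_real {z}) x) \<le> 0"
  proof (rule sum_nonpos)
    fix z
    show "c z * T (indicat_real {z}) x \<le> 0"
    proof (cases "(x, z) \<in> G")
      case True
      then have "c z = 0"
        using assms[of z] by (auto simp: c_def)
      then show ?thesis by simp
    next
      case False
      then show ?thesis
        by (auto simp: upper_access_graph_def c_def mult_nonneg_nonpos)
    qed
  qed
  finally show ?thesis
    by simp
qed

lemma eq_const_if_eq_on_successors:
  assumes "\<And>y. (x, y) \<in> G \<Longrightarrow> f y = c"
  shows "T f x = c"
  using le_if_le_on_successors[of x f "\<lambda>_. c"] le_if_le_on_successors[of x "\<lambda>_. c" f] assms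
  by fastforce

lemma successor_exists: "\<exists>y. (x, y) \<in> G"
proof (rule ccontr)
  assume "\<nexists>y. (x, y) \<in> G"
  \<comment> \<open>Without successors the premise of the rule is vacuous, so it would yield any
    value, here 1.\<close>
  then have "T (\<lambda>_. 0) x = 1"
    by (intro eq_const_if_eq_on_successors) auto
  then show False
    by simp
qed

text \<open>Allows the locale to be interpreted for iterates, so that monotonicity and the other
  basic laws carry over to \<open>T ^^ n\<close>.\<close>

lemma upper_transition_pow: "upper_transition (T ^^ n)"
proof (induction n)
  case 0
  show ?case
    by unfold_locales (auto simp: upper_transition_operator_def le_fun_def)
next
  case (Suc n)
  interpret P: upper_transition "T ^^ n"
    by (rule Suc)
  have "T ((T ^^ n) (\<lambda>x. f x + g x)) x \<le> T ((T ^^ n) f) x + T ((T ^^ n) g) x" for f g x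
    by (rule order_trans[OF mono[OF P.subadditive] subadditive])
  moreover have "T ((T ^^ n) (\<lambda>x. c * f x)) x = c * T ((T ^^ n) f) x" if "c \<ge> 0" for c f x
  proof -
    have "(T ^^ n) (\<lambda>x. c * f x) = (\<lambda>x. c * (T ^^ n) f x)"
      using P.homogeneous[OF that] by auto
    then show ?thesis
      using homogeneous[OF that] by simp
  qed
  moreover have "T ((T ^^ n) f) x \<le> Max (range f)" for f x
    by (intro upper_bound P.upper_bound) simp
  ultimately show ?case
    by unfold_locales (auto simp: upper_transition_operator_def le_fun_def)
qed

text \<open>If \<open>z\<close> is the first state after \<open>x\<close> on the path, then the
  previous iterate dominates its own positive value at \<open>z\<close> times the indicator of
  \<open>z\<close>.\<close>

lemma pow_indicator_pos:
  assumes "(x, y) \<in> G ^^ n"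
  shows "(T ^^ n) (indicat_real {y}) x > 0"
  using assms
proof (induction n arbitrary: x)
  case 0
  then show ?case by simp
next
  case (Suc n)
  interpret P: upper_transition "T ^^ n"
    by (rule upper_transition_pow)
  obtain z where z: "(x, z) \<in> G" "(z, y) \<in> G ^^ n"
    using Suc.prems by (meson relpow_Suc_D2)
  let ?g = "(T ^^ n) (indicat_real {y})"
  have "?g w \<ge> 0" for w
    using P.mono[of "\<lambda>_. 0" "indicat_real {y}" w] by simp
  then have "T (\<lambda>w. ?g z * indicat_real {z} w) x \<le> T ?g x"
    by (intro mono) (auto simp: indicator_def)
  moreover have "?g z > 0" "T (indicat_real {z}) x > 0"
    using Suc.IH z by (auto simp: upper_access_graph_def)
  ultimately show ?case
    by (simp add: homogeneous) (meson less_le_trans mult_pos_pos)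
qed

section \<open>Structure of maximal communication classes\<close>

lemma equiv_communicate: "equiv UNIV (communicate T)"
  by (auto simp: equiv_def refl_on_def sym_def trans_def communicate_def accessible_def
      intro: rtrancl_trans)

lemma maximal_class_nonempty: "C \<in> maximal_classes T \<Longrightarrow> C \<noteq> {}"
  using in_quotient_imp_non_empty[OF equiv_communicate]
  by (auto simp: maximal_classes_def communication_classes_def)

lemma maximal_class_closed:
  "C \<in> maximal_classes T \<Longrightarrow> x \<in> C \<Longrightarrow> (x, y) \<in> G \<Longrightarrow> y \<in> C"
  by (auto simp: maximal_classes_def accessible_def)

text \<open>No edge leaves \<open>C\<close>, so by locality the values outside \<open>C\<close>
  never enter.\<close>

lemma pow_le_on_maximal_class:
  assumes C: "C \<in> maximal_classes T"
    and "\<And>x. x \<in> C \<Longrightarrow> f x \<le> g x" and "x \<in> C"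
  shows "(T ^^ n) f x \<le> (T ^^ n) g x"
  using assms(3)
proof (induction n arbitrary: x)
  case 0
  then show ?case using assms(2) by simp
next
  case (Suc n)
  then show ?case
    by (auto intro!: le_if_le_on_successors dest: maximal_class_closed[OF C])
qed

lemma maximal_class_connected:
  assumes C: "C \<in> maximal_classes T" and xy: "x \<in> C" "y \<in> C"
  shows "(x, y) \<in> (G \<inter> C \<times> C)\<^sup>*"
proof -
  have "(x, y) \<in> communicate T"
    using quotient_eq_iff[OF equiv_communicate, of C C x y] C xy
    by (auto simp: maximal_classes_def communication_classes_def)
  then have "(x, y) \<in> G\<^sup>*"
    by (auto simp: communicate_def accessible_def)
  then have "(x, y) \<in> (G \<inter> C \<times> C)\<^sup>* \<and> y \<in> C"
  proof induction
    case base
    then show ?case using xy by simp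
  next
    case (step y z)
    then show ?case
      using maximal_class_closed[OF C, of y z] by (auto intro: rtrancl_into_rtrancl)
  qed
  then show ?thesis ..
qed

section \<open>Convergence forces regularity\<close>

lemma regular_if_convergent:
  assumes conv: "convergent_operator T" and C: "C \<in> maximal_classes T"
  shows "regular_class T C"
proof -
  define E where "E = G \<inter> C \<times> C"
  define d where "d = Gcd (closed_path_lengths T C)"
  obtain x0 where x0: "x0 \<in> C"
    using maximal_class_nonempty[OF C] by blast
  have EI: "(x, y) \<in> E" if "x \<in> C" "(x, y) \<in> G" for x y
    using that maximal_class_closed[OF C] by (auto simp: E_def)
  have return_path: "\<exists>r. (x, x0) \<in> E ^^ r" if "x \<in> C" for x
    using maximal_class_connected[OF C that x0] unfolding rtrancl_power E_def .
  have d_dvd: "d dvd n" if "(x0, x0) \<in> E ^^ n" for n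
    using that x0 by (cases "n = 0") (auto simp: d_def closed_path_lengths_def E_def intro!: Gcd_dvd)
  \<comment> \<open>The cyclic subclass of \<open>x0\<close>.\<close>
  define D where "D = {y. \<exists>k. (x0, y) \<in> E ^^ (d * k)}"
  \<comment> \<open>All successors of \<open>x\<close> are reached from \<open>x0\<close> in
    \<open>m + 1\<close> steps, so by induction the previous iterate is constant on them and
    \<open>T\<close> returns that constant.\<close>
  have pow_D: "(T ^^ n) (indicat_real D) x = (if d dvd m + n then 1 else 0)"
    if "(x0, x) \<in> E ^^ m" "x \<in> C" for m n x
    using that
  proof (induction n arbitrary: m x)
    case 0
    have "d dvd m" if x: "x \<in> D"
    proof -
      obtain r where r: "(x, x0) \<in> E ^^ r"
        using return_path 0 by blast
      obtain k where "(x0, x) \<in> E ^^ (d * k)"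
        using x by (auto simp: D_def)
      \<comment> \<open>One return path closes both paths from \<open>x0\<close> to
        \<open>x\<close>; comparing the two loops gives the same length modulo
        \<open>d\<close>.\<close>
      then have "d dvd d * k + r" "d dvd m + r"
        using 0 r by (auto intro!: d_dvd relpow_trans)
      then show ?thesis
        by (metis dvd_add_left_iff dvd_add_right_iff dvd_triv_left)
    qed
    moreover have "x \<in> D" if "d dvd m"
      using that 0 by (auto simp: D_def elim!: dvdE)
    ultimately show ?case
      by (auto simp: indicator_def)
  next
    case (Suc n)
    have "T ((T ^^ n) (indicat_real D)) x = (if d dvd m + Suc n then 1 else 0)"
    proof (rule eq_const_if_eq_on_successors)
      fix y assume "(x, y) \<in> G"
      then have "(x0, y) \<in> E ^^ Suc m" "y \<in> C"
        using Suc.prems EI[of x y] maximal_class_closed[OF C, of x y] by (auto intro: relpow_Suc_I)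
      then show "(T ^^ n) (indicat_real D) y = (if d dvd m + Suc n then 1 else 0)"
        using Suc.IH[of y "Suc m"] by simp
    qed
    then show ?case
      by simp
  qed
  \<comment> \<open>The gcd of the empty set is 0, so a closed path of positive length has to be
    exhibited.\<close>
  have "d \<noteq> 0"
  proof -
    obtain y where y: "(x0, y) \<in> G"
      using successor_exists by blast
    then have "(x0, y) \<in> E" "y \<in> C"
      using EI x0 by (auto simp: E_def)
    then obtain r where "(x0, x0) \<in> E ^^ Suc r"
      using return_path by (meson relpow_Suc_I2)
    then have "Suc r \<in> closed_path_lengths T C"
      using x0 by (auto simp: closed_path_lengths_def E_def)
    then show ?thesis
      unfolding d_def by (metis Gcd_0_iff Zero_not_Suc singletonD subsetD)
  qed
  obtain L where "(\<lambda>n. (T ^^ n) (indicat_real D)) \<longlonglongrightarrow> L"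
    using conv by (auto simp: convergent_operator_def convergent_def)
  then have "(\<lambda>n. (T ^^ n) (indicat_real D) x0) \<longlonglongrightarrow> L x0"
    by (simp add: tendsto_fun_iff)
  then have lim: "(\<lambda>n. if d dvd n then 1 else 0) \<longlonglongrightarrow> L x0"
    using pow_D[of x0 0] x0 by simp
  \<comment> \<open>Along the multiples of \<open>d\<close> the value at \<open>x0\<close> is 1; one
    step later it is 1 only if \<open>d = 1\<close>.\<close>
  have "(\<lambda>n. if d dvd d * n then 1 else 0) \<longlonglongrightarrow> L x0"
    "(\<lambda>n. if d dvd d * n + 1 then 1 else 0) \<longlonglongrightarrow> L x0"
    using \<open>d \<noteq> 0\<close>
    by (intro filterlim_compose[OF lim] filterlim_subseq; simp add: strict_mono_def)+
  moreover have "d dvd d * n + 1 \<longleftrightarrow> d = 1" for n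
    by (subst dvd_add_right_iff) auto
  ultimately have "d = 1"
    by (auto simp: tendsto_const_iff split: if_splits)
  then show ?thesis
    by (simp add: regular_class_def d_def)
qed

section \<open>Contraction of the oscillation on regular classes\<close>

lemma uniformly_positive_if_regular:
  assumes C: "C \<in> maximal_classes T" and reg: "regular_class T C"
  shows "\<exists>N e. e > 0 \<and> e \<le> 1 \<and> (\<forall>x\<in>C. \<forall>y\<in>C. (T ^^ N) (indicat_real {y}) x \<ge> e)"
proof -
  obtain N where N: "\<And>x y. x \<in> C \<Longrightarrow> y \<in> C \<Longrightarrow> (x, y) \<in> (G \<inter> C \<times> C) ^^ N"
    using strongly_connected_aperiodic_imp_primitive[of C "G \<inter> C \<times> C"]
      maximal_class_connected[OF C] reg
    unfolding regular_class_def closed_path_lengths_def by (metis (no_types, lifting) finite order_refl)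
  have pos: "(T ^^ N) (indicat_real {y}) x > 0" if "x \<in> C" "y \<in> C" for x y
    using N[OF that] relpow_subset_mono[of "G \<inter> C \<times> C" G N] by (intro pow_indicator_pos) blast
  \<comment> \<open>The inserted 1 gives \<open>e \<le> 1\<close>, so that the contraction factor
    \<open>1 - e\<close> is nonnegative.\<close>
  define e where "e = Min (insert 1 ((\<lambda>(x, y). (T ^^ N) (indicat_real {y}) x) ` (C \<times> C)))"
  have "e > 0"
    unfolding e_def using pos by (subst Min_gr_iff) auto
  moreover have "e \<le> 1" "\<And>x y. x \<in> C \<Longrightarrow> y \<in> C \<Longrightarrow> e \<le> (T ^^ N) (indicat_real {y}) x"
    unfolding e_def by (auto intro!: Min_le)
  ultimately show ?thesis
    by blast
qed

text \<open>With \<open>y\<close> a maximiser of \<open>g\<close> on \<open>C\<close>, there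
  \<open>g\<close> dominates \<open>l\<close> plus \<open>u - l\<close> times the indicator of
  \<open>y\<close>. Applying \<open>T ^^ N\<close> raises the lower bound by
  \<open>e * (u - l)\<close>, while \<open>u\<close> remains an upper bound.\<close>

lemma oscillation_contracts:
  assumes C: "C \<in> maximal_classes T" and e1: "e \<le> 1"
    and pos: "\<And>x y. x \<in> C \<Longrightarrow> y \<in> C \<Longrightarrow> (T ^^ N) (indicat_real {y}) x \<ge> e"
    and g: "\<And>x. x \<in> C \<Longrightarrow> a \<le> g x" "\<And>x. x \<in> C \<Longrightarrow> g x \<le> b"
  shows "\<exists>a' b'. b' - a' \<le> (1 - e) * (b - a) \<and>
    (\<forall>x\<in>C. a' \<le> (T ^^ N) g x \<and> (T ^^ N) g x \<le> b')"
proof -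
  interpret P: upper_transition "T ^^ N"
    by (rule upper_transition_pow)
  note le = pow_le_on_maximal_class[OF C]
  define l u where "l = Min (g ` C)" and "u = Max (g ` C)"
  have ne: "g ` C \<noteq> {}"
    using maximal_class_nonempty[OF C] by simp
  have lu: "l \<le> g x" "g x \<le> u" if "x \<in> C" for x
    using that by (auto simp: l_def u_def)
  have "l \<in> g ` C" "u \<in> g ` C"
    using ne by (auto simp: l_def u_def intro!: Min_in Max_in)
  then obtain y where y: "y \<in> C" "g y = u" and "a \<le> l" "u \<le> b" "l \<le> u"
    using g lu by auto
  have low: "l + e * (u - l) \<le> (T ^^ N) g x" if x: "x \<in> C" for x
  proof -
    have "e * (u - l) \<le> (T ^^ N) (indicat_real {y}) x * (u - l)"
      using pos[OF x y(1)] \<open>l \<le> u\<close> by (intro mult_right_mono) auto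
    also have "\<dots> + l = (T ^^ N) (\<lambda>z. (u - l) * indicat_real {y} z + l) x"
      using \<open>l \<le> u\<close> by (simp only: P.add_const P.homogeneous) simp
    also have "\<dots> \<le> (T ^^ N) g x"
      using lu y by (intro le[OF _ x]) (auto simp: indicator_def)
    finally show ?thesis
      by simp
  qed
  have "(T ^^ N) g x \<le> u" if "x \<in> C" for x
    using le[of g "\<lambda>_. u" x N] lu that by simp
  moreover have "u - (l + e * (u - l)) \<le> (1 - e) * (b - a)"
    using mult_left_mono[of "u - l" "b - a" "1 - e"] e1 \<open>a \<le> l\<close> \<open>u \<le> b\<close>
    by (simp add: algebra_simps)
  ultimately show ?thesis
    using low by blast
qed

lemma Cauchy_on_regular_class:
  assumes C: "C \<in> maximal_classes T" and reg: "regular_class T C" and "r > 0"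
  shows "\<exists>n0. \<forall>m\<ge>n0. \<forall>n\<ge>n0. \<forall>x\<in>C. \<bar>(T ^^ m) f x - (T ^^ n) f x\<bar> \<le> r"
proof -
  note le = pow_le_on_maximal_class[OF C]
  obtain N e where e: "e > 0" "e \<le> 1"
    and pos: "\<And>x y. x \<in> C \<Longrightarrow> y \<in> C \<Longrightarrow> (T ^^ N) (indicat_real {y}) x \<ge> e"
    using uniformly_positive_if_regular[OF C reg] by blast
  define a0 b0 where "a0 = Min (range f)" and "b0 = Max (range f)"
  have "\<exists>a b. b - a \<le> (1 - e) ^ k * (b0 - a0) \<and>
      (\<forall>x\<in>C. a \<le> (T ^^ (N * k)) f x \<and> (T ^^ (N * k)) f x \<le> b)" for k
  proof (induction k)
    case 0
    show ?case
      by (rule exI[of _ a0], rule exI[of _ b0]) (auto simp: a0_def b0_def)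
  next
    case (Suc k)
    then obtain a b where ab: "b - a \<le> (1 - e) ^ k * (b0 - a0)"
      "\<And>x. x \<in> C \<Longrightarrow> a \<le> (T ^^ (N * k)) f x" "\<And>x. x \<in> C \<Longrightarrow> (T ^^ (N * k)) f x \<le> b"
      by blast
    obtain a' b' where ab': "b' - a' \<le> (1 - e) * (b - a)"
      "\<forall>x\<in>C. a' \<le> (T ^^ N) ((T ^^ (N * k)) f) x \<and> (T ^^ N) ((T ^^ (N * k)) f) x \<le> b'"
      using oscillation_contracts[of C e N a "(T ^^ (N * k)) f" b] C e pos ab(2,3) by blast
    have "(1 - e) * (b - a) \<le> (1 - e) ^ Suc k * (b0 - a0)"
      using mult_left_mono[OF ab(1), of "1 - e"] e by (simp add: mult.assoc)
    then show ?case
      using ab' by (intro exI[of _ a'] exI[of _ b']) (auto simp: funpow_add)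
  qed
  moreover have "(\<lambda>k. (1 - e) ^ k * (b0 - a0)) \<longlonglongrightarrow> 0 * (b0 - a0)"
    using e by (intro tendsto_intros LIMSEQ_power_zero) auto
  then have "\<forall>\<^sub>F k in sequentially. (1 - e) ^ k * (b0 - a0) < r"
    using \<open>r > 0\<close> by (auto intro: order_tendstoD)
  then obtain k where "(1 - e) ^ k * (b0 - a0) < r"
    by (auto simp: eventually_sequentially)
  ultimately obtain a b where ab: "b - a < r"
    "\<And>x. x \<in> C \<Longrightarrow> a \<le> (T ^^ (N * k)) f x" "\<And>x. x \<in> C \<Longrightarrow> (T ^^ (N * k)) f x \<le> b"
    by (meson le_less_trans)
  \<comment> \<open>Constants are fixed and the order on \<open>C\<close> is preserved, so the
    interval from \<open>a\<close> to \<open>b\<close> is never left again.\<close>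
  have "a \<le> (T ^^ n) f x \<and> (T ^^ n) f x \<le> b" if "x \<in> C" "n \<ge> N * k" for x n
  proof -
    interpret P: upper_transition "T ^^ (n - N * k)"
      by (rule upper_transition_pow)
    have "(T ^^ n) f = (T ^^ (n - N * k)) ((T ^^ (N * k)) f)"
      using that(2) by (metis funpow_add comp_apply le_add_diff_inverse2)
    then show ?thesis
      using le[of "\<lambda>_. a" "(T ^^ (N * k)) f" x "n - N * k"]
        le[of "(T ^^ (N * k)) f" "\<lambda>_. b" x "n - N * k"] ab that(1) by auto
  qed
  then have "\<bar>(T ^^ m) f x - (T ^^ n) f x\<bar> \<le> r" if "x \<in> C" "m \<ge> N * k" "n \<ge> N * k" for x m n
    using ab(1) that by (smt (verit))
  then show ?thesis
    by blast
qed

section \<open>Absorption into the maximal classes\<close>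

lemma conj_lower_pow: "(conj_lower T ^^ n) f x = - (T ^^ n) (\<lambda>y. - f y) x"
  by (induction n arbitrary: x) (auto simp: conj_lower_def fun_eq_iff)

text \<open>The upper probability of being outside the maximal classes after \<open>n\<close>
  steps.\<close>

abbreviation "escape n \<equiv> (T ^^ n) (indicat_real (- maximal_states T))"

lemma escape_nonneg: "escape n x \<ge> 0"
proof -
  interpret P: upper_transition "T ^^ n"
    by (rule upper_transition_pow)
  show ?thesis
    using P.mono[of "\<lambda>_. 0" "indicat_real (- maximal_states T)" x] by simp
qed

lemma escape_one_le: "escape 1 x \<le> indicat_real (- maximal_states T) x"
proof (cases "x \<in> maximal_states T")
  case True
  then have "T (indicat_real (- maximal_states T)) x = 0"
    by (intro eq_const_if_eq_on_successors)
      (auto simp: maximal_states_def indicator_def dest: maximal_class_closed)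
  then show ?thesis
    by simp
next
  case False
  then show ?thesis
    by (simp add: upper_bound indicator_def)
qed

text \<open>Maximal states lead only to maximal states, which is the comparison of
  \<open>escape 1\<close> with \<open>escape 0\<close>; the monotone iterates propagate it.\<close>

lemma escape_decreasing: "m \<le> n \<Longrightarrow> escape n x \<le> escape m x"
proof (induction n rule: dec_induct)
  case (step n)
  interpret P: upper_transition "T ^^ n"
    by (rule upper_transition_pow)
  have "(T ^^ n) (escape 1) x \<le> escape n x"
    by (intro P.mono escape_one_le)
  then show ?case
    using step.IH by (simp add: funpow_swap1)
qed simp

lemma escape_lt_one:
  assumes "non_absorbed_states T = {}"
  shows "\<exists>n. escape n x < 1"
proof (cases "x \<in> maximal_states T")
  case True
  then have "escape 0 x < 1"
    by simp
  then show ?thesis ..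
next
  case False
  then have "lower_reachable T (maximal_states T) x"
    using assms by (auto simp: non_absorbed_states_def)
  then obtain n where n: "(T ^^ n) (\<lambda>y. - indicat_real (maximal_states T) y) x < 0"
    by (auto simp: lower_reachable_def conj_lower_pow)
  interpret P: upper_transition "T ^^ n"
    by (rule upper_transition_pow)
  \<comment> \<open>Hence the lower iterate of the indicator of the maximal states is 1 minus
    \<open>escape n x\<close>.\<close>
  have "(\<lambda>y. - indicat_real (maximal_states T) y)
      = (\<lambda>y. indicat_real (- maximal_states T) y + - 1)"
    by (auto simp: indicator_def)
  with n show ?thesis
    using P.add_const[of "indicat_real (- maximal_states T)" "- 1" x] by (intro exI[of _ n]) simp
qed

text \<open>By finiteness one \<open>N\<close> brings \<open>escape N\<close> below some
  \<open>q < 1\<close> everywhere. Each further block of \<open>N\<close> steps costs another factor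
  \<open>q\<close>, and monotonicity in \<open>n\<close> covers the times in between.\<close>

lemma escape_vanishes:
  assumes "non_absorbed_states T = {}" and "r > 0"
  shows "\<exists>n0. \<forall>n\<ge>n0. \<forall>x. escape n x \<le> r"
proof -
  obtain K where K: "\<And>x. escape (K x) x < 1"
    using escape_lt_one[OF assms(1)] by metis
  define N where "N = Max (range K)"
  define q where "q = Max (range (escape N))"
  have "escape N x < 1" for x
    using K[of x] escape_decreasing[of "K x" N x] by (simp add: N_def)
  then have "q < 1"
    by (simp add: q_def)
  have q_ge: "escape N x \<le> q" for x
    by (simp add: q_def)
  have "q \<ge> 0"
    using escape_nonneg q_ge order_trans by blast
  \<comment> \<open>On maximal states \<open>escape N\<close> is at most \<open>escape 0\<close>,
    which is 0 there. The indicator on the right is what allows the bound to be iterated.\<close>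
  have q_escape: "escape N x \<le> q * indicat_real (- maximal_states T) x" for x
    using q_ge[of x] escape_decreasing[of 0 N x] by (auto simp: indicator_def)
  have power: "escape (k * N) x \<le> q ^ k" for k x
  proof (induction k arbitrary: x)
    case 0
    show ?case
      by (simp add: indicator_def)
  next
    case (Suc k)
    interpret P: upper_transition "T ^^ (k * N)"
      by (rule upper_transition_pow)
    have "escape (Suc k * N) x = (T ^^ (k * N)) (escape N) x"
      by (simp add: add.commute[of N] funpow_add)
    also have "\<dots> \<le> (T ^^ (k * N)) (\<lambda>y. q * indicat_real (- maximal_states T) y) x"
      by (intro P.mono q_escape)
    also have "\<dots> = q * escape (k * N) x"
      using \<open>q \<ge> 0\<close> by (rule P.homogeneous)
    also have "\<dots> \<le> q ^ Suc k"
      using Suc \<open>q \<ge> 0\<close> by (simp add: mult_left_mono)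
    finally show ?case .
  qed
  obtain k where "q ^ k < r"
    using \<open>q < 1\<close> \<open>r > 0\<close> by (meson real_arch_pow_inv)
  then have "escape n x \<le> r" if "n \<ge> k * N" for n x
    using escape_decreasing[OF that, of x] power[of k x] by linarith
  then show ?thesis
    by blast
qed

section \<open>Convergence from regularity and absorption\<close>

lemma convergent_if_regular:
  assumes absorbed: "non_absorbed_states T = {}"
    and reg: "\<And>C. C \<in> maximal_classes T \<Longrightarrow> regular_class T C"
  shows "convergent_operator T"
  unfolding convergent_operator_def
proof
  fix f :: "'x \<Rightarrow> real"
  \<comment> \<open>The inserted 1 makes \<open>M\<close> positive, as the division by
    \<open>2 * M\<close> below requires.\<close>
  define M where "M = Max (insert 1 (range (\<lambda>x. \<bar>f x\<bar>)))"
  have fM: "\<bar>f x\<bar> \<le> M" for x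
    unfolding M_def by (intro Max_ge) auto
  have "M \<ge> 1"
    unfolding M_def by (intro Max_ge) auto
  have pow_M: "\<bar>(T ^^ n) f x\<bar> \<le> M" for n x
  proof -
    interpret P: upper_transition "T ^^ n"
      by (rule upper_transition_pow)
    have f: "- M \<le> f y" "f y \<le> M" for y
      using fM[of y] by auto
    show ?thesis
      using P.mono[of "\<lambda>_. - M" f x] P.upper_bound[of f M x] f by (simp add: abs_le_iff)
  qed
  have "Cauchy (\<lambda>n. (T ^^ n) f x)" for x
  proof (rule CauchyI)
    fix r :: real
    assume "r > 0"
    \<comment> \<open>One share for the error on the maximal classes and one for the escape term;
      the third keeps the final inequality strict.\<close>
    define d where "d = r / 3"
    have "d > 0"
      using \<open>r > 0\<close> by (simp add: d_def)
    have "\<exists>n0. \<forall>m\<ge>n0. \<forall>n\<ge>n0. \<forall>y\<in>C. \<bar>(T ^^ m) f y - (T ^^ n) f y\<bar> \<le> d"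
      if "C \<in> maximal_classes T" for C
      using Cauchy_on_regular_class[OF that reg[OF that] \<open>d > 0\<close>] .
    then obtain K where K: "\<And>C m n y. C \<in> maximal_classes T \<Longrightarrow> m \<ge> K C \<Longrightarrow> n \<ge> K C
        \<Longrightarrow> y \<in> C \<Longrightarrow> \<bar>(T ^^ m) f y - (T ^^ n) f y\<bar> \<le> d"
      by metis
    define n1 where "n1 = Max (range K)"
    have "K C \<le> n1" for C
      by (simp add: n1_def)
    then have close: "\<bar>(T ^^ m) f y - (T ^^ n) f y\<bar> \<le> d"
      if "y \<in> maximal_states T" "m \<ge> n1" "n \<ge> n1" for m n y
      using that K unfolding maximal_states_def by (meson UnionE order_trans)
    obtain n2 where n2: "\<And>y. escape n2 y \<le> d / (2 * M)"
      using escape_vanishes[OF absorbed, of "d / (2 * M)"] \<open>d > 0\<close> \<open>M \<ge> 1\<close> by auto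
    interpret P: upper_transition "T ^^ n2"
      by (rule upper_transition_pow)
    have le: "(T ^^ m) f x \<le> (T ^^ n) f x + 2 * d" if mn: "m \<ge> n1 + n2" "n \<ge> n1 + n2" for m n
    proof -
      have shift: "(T ^^ k) f = (T ^^ n2) ((T ^^ (k - n2)) f)" if "k \<ge> n1 + n2" for k
        using that by (metis add_leD2 comp_apply funpow_add le_add_diff_inverse)
      \<comment> \<open>Before the last \<open>n2\<close> steps, the error is \<open>d\<close> on
        maximal states and at most \<open>2 * M\<close> elsewhere; those steps damp the second part
        to \<open>d\<close>.\<close>
      have "(T ^^ (m - n2)) f y
          \<le> (T ^^ (n - n2)) f y + 2 * M * indicat_real (- maximal_states T) y + d" for y
        using close[of y "m - n2" "n - n2"] pow_M[of "m - n2" y] pow_M[of "n - n2" y]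
          mn \<open>d > 0\<close> add_le_imp_le_diff[OF mn(1)] add_le_imp_le_diff[OF mn(2)]
        by (cases "y \<in> maximal_states T") (auto simp: abs_le_iff)
      then have "(T ^^ m) f x
          \<le> (T ^^ n2) (\<lambda>y. (T ^^ (n - n2)) f y + 2 * M * indicat_real (- maximal_states T) y + d) x"
        unfolding shift[OF mn(1)] by (rule P.mono)
      also have "\<dots> = (T ^^ n2)
          (\<lambda>y. (T ^^ (n - n2)) f y + 2 * M * indicat_real (- maximal_states T) y) x + d"
        by (rule P.add_const)
      also have "\<dots> \<le> (T ^^ n) f x + (T ^^ n2) (\<lambda>y. 2 * M * indicat_real (- maximal_states T) y) x + d"
        unfolding shift[OF mn(2)] by (intro add_right_mono P.subadditive)
      also have "(T ^^ n2) (\<lambda>y. 2 * M * indicat_real (- maximal_states T) y) x = 2 * M * escape n2 x"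
        using \<open>M \<ge> 1\<close> by (intro P.homogeneous) simp
      also have "\<dots> \<le> d"
        using n2[of x] \<open>M \<ge> 1\<close> by (simp add: field_simps)
      finally show ?thesis
        by simp
    qed
    have "norm ((T ^^ m) f x - (T ^^ n) f x) < r" if "m \<ge> n1 + n2" "n \<ge> n1 + n2" for m n
      using le[OF that] le[OF that(2,1)] \<open>r > 0\<close> by (simp add: d_def abs_le_iff)
    then show "\<exists>N. \<forall>m\<ge>N. \<forall>n\<ge>N. norm ((T ^^ m) f x - (T ^^ n) f x) < r"
      by blast
  qed
  then have "\<exists>l. (\<lambda>n. (T ^^ n) f x) \<longlonglongrightarrow> l" for x
    by (auto simp: Cauchy_convergent_iff convergent_def)
  then obtain l where "\<And>x. (\<lambda>n. (T ^^ n) f x) \<longlonglongrightarrow> l x"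
    by metis
  then have "(\<lambda>n. (T ^^ n) f) \<longlonglongrightarrow> l"
    by (simp add: tendsto_fun_iff)
  then show "convergent (\<lambda>n. (T ^^ n) f)"
    by (rule convergentI)
qed

end

theorem corollary16:
  fixes T :: "('x::finite \<Rightarrow> real) \<Rightarrow> ('x \<Rightarrow> real)"
  assumes "upper_transition_operator T"
    and "non_absorbed_states T = {}"
  shows "convergent_operator T \<longleftrightarrow> (\<forall>C\<in>maximal_classes T. regular_class T C)"
proof -
  interpret upper_transition T
    by unfold_locales (rule assms(1))
  show ?thesis
    using regular_if_convergent convergent_if_regular[OF assms(2)] by blast
qed

end
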